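(* Let $X=\{1,2,\ldots,r\}$ with $r\ge 1$. A relation $U$ on $X$ is bipartitional if and only if it is a $\kappa$-extension of itself.
   Context: A relation on $X$ is a subset of $X\times X$; $x\,U\,y$ means $(x,y)\in U$. A relation $U$ on $X$ is bipartitional if there exist an ordered partition $(B_1,\ldots,B_k)$ of $X$ into blocks and a sequence $(\beta_1,\ldots,\beta_k)$ of 0's and 1's such that $x\,U\,y$ if and only if either (1) $x\in B_l$, $y\in B_{l'}$ and $l<l'$, or (2) $x,y\in B_l$ and $\beta_l=1$. A relation $S$ on $X$ is a $\kappa$-extension of a relation $U$ on $X$ if (1) $U\subseteq S$ and (2) for all $x,y,z\in X$: if $(x,y)\in U$ and $(z,y)\notin U$, then $(x,z)\in S$ and $(z,x)\notin S$. *)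

theory Defs
  imports Main "HOL-Library.Disjoint_Sets"
begin

text \<open>
  An ordered partition of \<open>X\<close> is a list of distinct blocks whose underlying set is a partition of
  \<open>X\<close> (\<^const>\<open>partition_on\<close>: the blocks are nonempty, pairwise disjoint, and their union is \<open>X\<close>).
\<close>

definition ordered_partition_on :: "'a set \<Rightarrow> 'a set list \<Rightarrow> bool" where
  "ordered_partition_on X Bs \<longleftrightarrow> distinct Bs \<and> partition_on X (set Bs)"

definition bipartitional_on :: "'a set \<Rightarrow> 'a rel \<Rightarrow> bool" where
  "bipartitional_on X U \<longleftrightarrow>
     U \<subseteq> X \<times> X \<and>
     (\<exists>(Bs :: 'a set list) (\<beta>s :: nat list).
        ordered_partition_on X Bs \<and>
        length \<beta>s = length Bs \<and> set \<beta>s \<subseteq> {0, 1} \<and>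
        (\<forall>x\<in>X. \<forall>y\<in>X. (x, y) \<in> U \<longleftrightarrow>
           (\<exists>l l'. l < l' \<and> l' < length Bs \<and> x \<in> Bs ! l \<and> y \<in> Bs ! l') \<or>
           (\<exists>l < length Bs. x \<in> Bs ! l \<and> y \<in> Bs ! l \<and> \<beta>s ! l = 1)))"

definition kappa_extension_on :: "'a set \<Rightarrow> 'a rel \<Rightarrow> 'a rel \<Rightarrow> bool" where
  "kappa_extension_on X S U \<longleftrightarrow>
     S \<subseteq> X \<times> X \<and> U \<subseteq> X \<times> X \<and>
     U \<subseteq> S \<and>
     (\<forall>x\<in>X. \<forall>y\<in>X. \<forall>z\<in>X.
        (x, y) \<in> U \<and> (z, y) \<notin> U \<longrightarrow> (x, z) \<in> S \<and> (z, x) \<notin> S)"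

end

theory Submission
  imports Defs
begin

text \<open>
  A relation is bipartitional iff it is described by a rank function with a flag on each rank, and
  such relations are clearly their own \<open>\<kappa>\<close>-extensions. Conversely, if \<open>U\<close> is its own
  \<open>\<kappa>\<close>-extension, then its asymmetric part \<open>P\<close> is a strict weak order; ranking \<open>x\<close> by the
  number of its \<open>P\<close>-predecessors recovers the ordered partition.
\<close>

text \<open>The rank of an element is the index of the only block containing it, and
  \<open>b\<close> reads off the flag of that block. Ranks replace the quantifiers over block
  indices by arithmetic.\<close>

lemma bipartitional_on_imp_rank:
  fixes X :: "'a set"
  assumes "bipartitional_on X U"
  obtains f :: "'a \<Rightarrow> nat" and b :: "nat \<Rightarrow> bool" where
    "\<And>x y. x \<in> X \<Longrightarrow> y \<in> X \<Longrightarrow> (x, y) \<in> U \<longleftrightarrow> f x < f y \<or> f x = f y \<and> b (f x)"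
proof -
  from assms obtain Bs :: "'a set list" and \<beta>s :: "nat list" where
    dist: "distinct Bs" and part: "partition_on X (set Bs)" and
    U: "\<forall>x\<in>X. \<forall>y\<in>X. (x, y) \<in> U \<longleftrightarrow>
           (\<exists>l l'. l < l' \<and> l' < length Bs \<and> x \<in> Bs ! l \<and> y \<in> Bs ! l') \<or>
           (\<exists>l < length Bs. x \<in> Bs ! l \<and> y \<in> Bs ! l \<and> \<beta>s ! l = 1)"
    unfolding bipartitional_on_def ordered_partition_on_def by (elim conjE exE) (rule that)
  have "\<forall>x\<in>X. \<exists>l. l < length Bs \<and> x \<in> Bs ! l"
    using partition_onD1[OF part] by (auto simp: in_set_conv_nth)
  then obtain f where f: "\<And>x. x \<in> X \<Longrightarrow> f x < length Bs \<and> x \<in> Bs ! f x"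
    by metis
  have uniq: "l = l'" if "l < length Bs" "l' < length Bs" "x \<in> Bs ! l" "x \<in> Bs ! l'" for x l l'
  proof -
    have "Bs ! l = Bs ! l'"
      using disjointD[OF partition_onD2[OF part], of "Bs ! l" "Bs ! l'"] that by auto
    with dist that show ?thesis by (simp add: nth_eq_iff_index_eq)
  qed
  have mem: "x \<in> Bs ! l \<longleftrightarrow> l = f x" if "x \<in> X" "l < length Bs" for x l
    using f uniq that by blast
  have "(x, y) \<in> U \<longleftrightarrow> f x < f y \<or> f x = f y \<and> \<beta>s ! f x = 1" if "x \<in> X" "y \<in> X" for x y
  proof -
    have "(\<exists>l l'. l < l' \<and> l' < length Bs \<and> x \<in> Bs ! l \<and> y \<in> Bs ! l') \<longleftrightarrow> f x < f y"
      using f that mem by (metis order.strict_trans)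
    moreover have "(\<exists>l < length Bs. x \<in> Bs ! l \<and> y \<in> Bs ! l \<and> \<beta>s ! l = 1) \<longleftrightarrow>
        f x = f y \<and> \<beta>s ! f x = 1"
      using f that mem by metis
    ultimately show ?thesis using U that by simp
  qed
  then show thesis by (rule that)
qed

text \<open>The blocks are the fibres of \<open>f\<close>, listed by increasing value.\<close>

lemma bipartitional_on_if_rank:
  fixes f :: "'a \<Rightarrow> nat" and b :: "nat \<Rightarrow> bool"
  assumes "finite X" and "U \<subseteq> X \<times> X"
    and rank: "\<And>x y. x \<in> X \<Longrightarrow> y \<in> X \<Longrightarrow> (x, y) \<in> U \<longleftrightarrow> f x < f y \<or> f x = f y \<and> b (f x)"
  shows "bipartitional_on X U"
proof -
  \<comment> \<open>Only attained values are listed, so every fibre is nonempty. As \<open>f\<close>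
    may skip values, \<open>ks\<close> translates block positions into ranks.\<close>
  define ks where "ks = sorted_list_of_set (f ` X)"
  define Bs where "Bs = map (\<lambda>k. {x \<in> X. f x = k}) ks"
  define \<beta>s where "\<beta>s = map (\<lambda>k. if b k then 1 else 0 :: nat) ks"
  have set_ks: "set ks = f ` X" and sorted: "sorted_wrt (<) ks"
    using \<open>finite X\<close> by (simp_all add: ks_def)
  have len: "length Bs = length ks" "length \<beta>s = length ks"
    by (simp_all add: Bs_def \<beta>s_def)
  have mem: "x \<in> Bs ! l \<longleftrightarrow> x \<in> X \<and> f x = ks ! l" if "l < length ks" for x l
    using that by (simp add: Bs_def)
  have mono: "ks ! l < ks ! l' \<longleftrightarrow> l < l'" if "l < length ks" "l' < length ks" for l l'
    using sorted that by (metis sorted_wrt_nth_less not_less_iff_gr_or_eq)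
  have inj: "ks ! l = ks ! l' \<longleftrightarrow> l = l'" if "l < length ks" "l' < length ks" for l l'
    using mono that by (metis not_less_iff_gr_or_eq)
  have "distinct Bs"
    unfolding Bs_def distinct_map
    using set_ks by (auto simp: ks_def inj_on_def)
  moreover have "partition_on X (set Bs)"
    by (rule partition_onI) (auto simp: Bs_def set_ks disjnt_def)
  moreover have "set \<beta>s \<subseteq> {0, 1}"
    by (auto simp: \<beta>s_def)
  moreover have "(x, y) \<in> U \<longleftrightarrow>
           (\<exists>l l'. l < l' \<and> l' < length Bs \<and> x \<in> Bs ! l \<and> y \<in> Bs ! l') \<or>
           (\<exists>l < length Bs. x \<in> Bs ! l \<and> y \<in> Bs ! l \<and> \<beta>s ! l = 1)"
    if xy: "x \<in> X" "y \<in> X" for x y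
  proof -
    obtain i j where i: "i < length ks" "f x = ks ! i" and j: "j < length ks" "f y = ks ! j"
      using xy set_ks by (metis imageI in_set_conv_nth)
    have x: "x \<in> Bs ! l \<longleftrightarrow> l = i" and y: "y \<in> Bs ! l \<longleftrightarrow> l = j" if "l < length ks" for l
      using that mem inj xy i j by auto
    have \<beta>: "\<beta>s ! l = 1 \<longleftrightarrow> b (ks ! l)" if "l < length ks" for l
      using that by (simp add: \<beta>s_def)
    have "(x, y) \<in> U \<longleftrightarrow> i < j \<or> i = j \<and> b (ks ! i)"
      using rank[OF xy] i j mono inj by simp
    moreover have "(\<exists>l l'. l < l' \<and> l' < length Bs \<and> x \<in> Bs ! l \<and> y \<in> Bs ! l') \<longleftrightarrow> i < j"
      using x y i j len by (metis order.strict_trans)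
    moreover have "(\<exists>l < length Bs. x \<in> Bs ! l \<and> y \<in> Bs ! l \<and> \<beta>s ! l = 1) \<longleftrightarrow>
        i = j \<and> b (ks ! i)"
      using x y i j len \<beta> by metis
    ultimately show ?thesis by simp
  qed
  ultimately show ?thesis
    unfolding bipartitional_on_def ordered_partition_on_def
    using \<open>U \<subseteq> X \<times> X\<close> len by (intro conjI exI[of _ Bs] exI[of _ \<beta>s] ballI) simp_all
qed

lemma bipartitional_on_imp_kappa_extension_on:
  assumes "bipartitional_on X U"
  shows "kappa_extension_on X U U"
proof -
  obtain f :: "'a \<Rightarrow> nat" and b where
    rank: "\<And>x y. x \<in> X \<Longrightarrow> y \<in> X \<Longrightarrow> (x, y) \<in> U \<longleftrightarrow> f x < f y \<or> f x = f y \<and> b (f x)"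
    using assms by (rule bipartitional_on_imp_rank) blast
  have "(x, z) \<in> U \<and> (z, x) \<notin> U"
    if "x \<in> X" "y \<in> X" "z \<in> X" "(x, y) \<in> U" "(z, y) \<notin> U" for x y z
  proof -
    \<comment> \<open>Otherwise f z \<le> f x. A smaller or equal rank in the first argument
      preserves membership, so \<open>(x, y) \<in> U\<close> would force
      \<open>(z, y) \<in> U\<close>.\<close>
    have "f x < f z"
      using that rank by (metis linorder_neqE_nat order.strict_trans)
    then show ?thesis using that rank by auto
  qed
  moreover have "U \<subseteq> X \<times> X"
    using assms by (simp add: bipartitional_on_def)
  ultimately show ?thesis
    unfolding kappa_extension_on_def by blast
qed

lemma kappa_extension_on_imp_bipartitional_on:
  assumes "finite X" and "kappa_extension_on X U U"
  shows "bipartitional_on X U"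
proof -
  have sub: "U \<subseteq> X \<times> X"
    using assms(2) unfolding kappa_extension_on_def by (elim conjE)
  have kappa: "(x, z) \<in> U \<and> (z, x) \<notin> U"
    if "x \<in> X" "y \<in> X" "z \<in> X" "(x, y) \<in> U" "(z, y) \<notin> U" for x y z
    using assms(2) that unfolding kappa_extension_on_def by metis
  define P where "P x y \<longleftrightarrow> (x, y) \<in> U \<and> (y, x) \<notin> U" for x y
  \<comment> \<open>If \<open>(w, x) \<in> U\<close>, then \<open>(z, x) \<notin> U\<close> yields
    \<open>P w z\<close>. If \<open>(w, x) \<notin> U\<close> and \<open>(w, z) \<notin> U\<close>,
    then \<open>(x, z) \<in> U\<close> yields \<open>P x w\<close>. In the remaining case, either
    \<open>(z, w) \<notin> U\<close> and \<open>P w z\<close> holds, or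
    \<open>(z, w) \<in> U\<close>; then \<open>(x, w) \<in> U\<close>, since otherwise
    \<open>kappa\<close> would put \<open>(z, x)\<close> into \<open>U\<close>, and so
    \<open>P x w\<close>.\<close>
  have weak: "P x w \<or> P w z" if "P x z" "x \<in> X" "z \<in> X" "w \<in> X" for x z w
    using that kappa unfolding P_def by metis
  have asym: "\<not> P y x" if "P x y" for x y
    using that by (simp add: P_def)
  define f where "f x = card {w \<in> X. P w x}" for x
  have less: "f x < f z" if "P x z" "x \<in> X" "z \<in> X" for x z
    unfolding f_def
  proof (rule psubset_card_mono)
    \<comment> \<open>From \<open>P w x\<close>, \<open>weak\<close> gives \<open>P w z\<close> or
      \<open>P z x\<close>, and asymmetry excludes the latter. The inclusion is strict because of
      \<open>x\<close> itself.\<close>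
    show "{w \<in> X. P w x} \<subset> {w \<in> X. P w z}"
      using that weak asym by blast
  qed (use \<open>finite X\<close> in simp)
  have eq: "f x = f z" if "\<not> P x z" "\<not> P z x" "x \<in> X" "z \<in> X" for x z
  proof -
    have "{w \<in> X. P w x} = {w \<in> X. P w z}"
      using that weak by blast
    then show ?thesis by (simp add: f_def)
  qed
  have P_iff: "P x z \<longleftrightarrow> f x < f z" if "x \<in> X" "z \<in> X" for x z
    using less eq that by (metis order_less_irrefl order_less_asym)
  \<comment> \<open>One reflexive element is enough to flag a rank: \<open>b_iff\<close> shows that
    all pairs within a rank behave alike.\<close>
  define b where "b k \<longleftrightarrow> (\<exists>x\<in>X. f x = k \<and> (x, x) \<in> U)" for k
  \<comment> \<open>If exactly one of the two pairs were in \<open>U\<close>, \<open>kappa\<close>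
    would make \<open>x\<close> and \<open>x'\<close> comparable under \<open>P\<close>, hence of
    different rank.\<close>
  have diag: "(x, y) \<in> U \<longleftrightarrow> (x', y) \<in> U" if "f x = f x'" "x \<in> X" "x' \<in> X" "y \<in> X" for x x' y
    using that kappa[of x y x'] kappa[of x' y x] P_iff[of x x'] P_iff[of x' x]
    unfolding P_def by auto
  have b_iff: "(x, y) \<in> U \<longleftrightarrow> b (f x)" if "f x = f y" "x \<in> X" "y \<in> X" for x y
  proof -
    have symm: "(v, w) \<in> U \<longleftrightarrow> (w, v) \<in> U" if "f v = f w" "v \<in> X" "w \<in> X" for v w
      using that P_iff[of v w] P_iff[of w v] unfolding P_def by auto
    \<comment> \<open>Pass from \<open>(x, y)\<close> to \<open>(z, y)\<close> by
      \<open>diag\<close>, to \<open>(y, z)\<close> by \<open>symm\<close>, and to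
      \<open>(z, z)\<close> by \<open>diag\<close> again.\<close>
    have "(x, y) \<in> U \<longleftrightarrow> (z, z) \<in> U" if "f z = f x" "z \<in> X" for z
      using that \<open>f x = f y\<close> \<open>x \<in> X\<close> \<open>y \<in> X\<close> diag symm by metis
    then show ?thesis
      using that unfolding b_def by metis
  qed
  show ?thesis
  proof (rule bipartitional_on_if_rank[OF \<open>finite X\<close> sub])
    fix x y assume xy: "x \<in> X" "y \<in> X"
    show "(x, y) \<in> U \<longleftrightarrow> f x < f y \<or> f x = f y \<and> b (f x)"
      using P_iff[OF xy] P_iff[OF xy(2,1)] b_iff[OF _ xy] unfolding P_def
      by (metis linorder_neqE_nat order_less_irrefl)
  qed
qed

theorem proposition1p5:
  fixes r :: nat and X :: "nat set" and U :: "nat rel"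
  assumes "r \<ge> 1" and "X = {1..r}" and "U \<subseteq> X \<times> X"
  shows "bipartitional_on X U \<longleftrightarrow> kappa_extension_on X U U"
proof
  have "finite X"
    using assms(2) by simp
  then show "bipartitional_on X U" if "kappa_extension_on X U U"
    using that by (rule kappa_extension_on_imp_bipartitional_on)
qed (rule bipartitional_on_imp_kappa_extension_on)

end
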